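(* Let $d$ be a positive integer and let $K \subset \mathbb{R}^d$ be a compact set. Suppose that for every $d(d+3)/2$ points in $K$ there exists a set $X \subset K$ of volume $1$ such that every point of $X$ sees each of the $d(d+3)/2$ points. Then there exists a set $X' \subset K$ of volume $d^{-d}$ such that every point of $X'$ sees every point of $K$.
   Context: For $K \subset \mathbb{R}^d$ and $x,y \in K$, we say $x$ sees $y$ (in $K$) if the closed segment $[x,y]$ is contained in $K$. Volume means $d$-dimensional Lebesgue measure. *)

theory Defs
  imports "HOL-Analysis.Analysis"
begin

(* Membership of x and y in K is automatic, since both are endpoints of the segment. *)
definition sees :: "'a::real_vector set \<Rightarrow> 'a \<Rightarrow> 'a \<Rightarrow> bool" where
  "sees K x y \<longleftrightarrow> closed_segment x y \<subseteq> K"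

end

theory Submission
  imports Defs "HOL-Library.Uprod"
begin

text \<open>By Krasnoselskii's argument, a point lying in the convex hull of the visibility region of every
  point of \<open>K\<close> sees all of \<open>K\<close>. So it suffices to find an ellipsoid of volume \<open>d\<^sup>-\<^sup>d\<close> in
  the intersection of these hulls. An ellipsoid is parametrised as \<open>b + L B\<close> with \<open>B\<close> the unit ball and
  \<open>L\<close> lower triangular with nonnegative diagonal, which takes exactly \<open>N = d(d+3)/2\<close> real parameters.
  The parameters of the ellipsoids inside a convex set form a convex set, and so do those with
  \<open>\<Prod>i. L\<^sub>i\<^sub>i \<ge> c\<close>, by the inequality between arithmetic and geometric means. By Helly's theorem
  in dimension \<open>N\<close>, it is enough that any \<open>N + 1\<close> of all these sets meet. If the volume constraint
  is among them, only \<open>N\<close> hulls are involved, and they contain a common convex body of volume at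
  least \<open>1\<close>, whose largest inscribed ellipsoid has volume at least \<open>d\<^sup>-\<^sup>d\<close> (John). If it is
  not, a degenerate ellipsoid suffices, that is, a common point, which exists by Helly's theorem in
  dimension \<open>d < N\<close>.\<close>

section \<open>Volumes of lower triangular images\<close>

text \<open>\<open>r\<close> ranks the index type, which has no order of its own; triangularity
  refers to this ranking.\<close>

definition lower_triangular :: "('n \<Rightarrow> nat) \<Rightarrow> real^'n^'n \<Rightarrow> bool" where
  "lower_triangular r L \<longleftrightarrow> (\<forall>i j. r i < r j \<longrightarrow> L $ i $ j = 0)"

text \<open>The factor is an explicit number instead of a determinant, so that a product of
  elementary maps yields it directly.\<close>

definition scales_measure_by :: "(real^'n \<Rightarrow> real^'n) \<Rightarrow> real \<Rightarrow> bool" where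
  "scales_measure_by f c \<longleftrightarrow> linear f \<and>
     (\<forall>S\<in>lmeasurable. f ` S \<in> lmeasurable \<and> measure lebesgue (f ` S) = c * measure lebesgue S)"

lemma scales_measure_by_id: "scales_measure_by (\<lambda>x. x) 1"
  by (simp add: scales_measure_by_def linear_ident)

lemma scales_measure_by_compose:
  assumes "scales_measure_by f a" "scales_measure_by g b"
  shows "scales_measure_by (f \<circ> g) (a * b)"
  using assms unfolding scales_measure_by_def image_comp[symmetric]
  by (simp add: linear_compose)

lemma scales_measure_by_stretch:
  "scales_measure_by (\<lambda>x :: real^'n. \<chi> k. m k * x $ k) \<bar>prod m UNIV\<bar>"
  unfolding scales_measure_by_def
  by (auto intro!: linearI measurable_stretch measure_stretch
      simp: plus_vec_def scaleR_vec_def algebra_simps)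

lemma scales_measure_by_unit_shear:
  assumes "m \<noteq> n"
  shows "scales_measure_by (\<lambda>x :: real^'n. \<chi> i. if i = m then x $ m + x $ n else x $ i) 1"
    (is "scales_measure_by ?h 1")
proof -
  have lin: "linear ?h"
    by (rule linearI) (auto simp: plus_vec_def scaleR_vec_def algebra_simps vec_eq_iff)
  have "measure lebesgue (?h ` cbox a b) = measure lebesgue (cbox a b)" for a b
  proof (cases "cbox a b = {}")
    case False
    \<comment> \<open>The shear formula for boxes asks for a nonnegative \<open>n\<close>-th
      coordinate of the lower corner, so the box is first moved to have its corner at 0.\<close>
    have eq: "cbox a b = (+) a ` cbox 0 (b - a)"
      by (simp add: cbox_translation[symmetric])
    have ne: "cbox 0 (b - a) \<noteq> {}" using False eq by auto
    have "?h ` cbox a b = (+) (?h a) ` ?h ` cbox 0 (b - a)"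
      unfolding eq image_image using linear_add[OF lin] by simp
    then have "measure lebesgue (?h ` cbox a b) = measure lebesgue (?h ` cbox 0 (b - a))"
      by (simp only: measure_translation)
    also have "\<dots> = measure lebesgue (cbox 0 (b - a))"
      using measure_shear_interval[OF assms ne] by simp
    also have "\<dots> = measure lebesgue (cbox a b)"
      unfolding eq by (rule measure_translation[symmetric])
    finally show ?thesis .
  qed simp
  then have "?h ` S \<in> lmeasurable \<and> 1 * measure lebesgue S = measure lebesgue (?h ` S)"
    if "S \<in> lmeasurable" for S
    by (intro measure_linear_sufficient[OF lin that]) (simp only: mult_1)
  then show ?thesis
    unfolding scales_measure_by_def using lin by (metis (no_types, lifting))
qed

text \<open>For nonzero \<open>a\<close> this is the unit shear conjugated by the stretch of
  coordinate \<open>n\<close> by \<open>a\<close>; the factors of the stretch and its inverse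
  cancel.\<close>

lemma scales_measure_by_shear:
  assumes "m \<noteq> n"
  shows "scales_measure_by (\<lambda>x :: real^'n. \<chi> i. if i = m then x $ m + a * x $ n else x $ i) 1"
    (is "scales_measure_by ?h 1")
proof (cases "a = 0")
  case True
  then have "?h = (\<lambda>x. x)" by (auto simp: fun_eq_iff vec_eq_iff)
  from this show ?thesis by (simp only: scales_measure_by_id)
next
  case False
  define st where "st c = (\<lambda>x :: real^'n. \<chi> k. (if k = n then c else 1) * x $ k)" for c
  have st: "scales_measure_by (st c) \<bar>c\<bar>" for c
    using scales_measure_by_stretch[of "\<lambda>k. if k = n then c else 1"]
    by (simp add: st_def prod.delta)
  have eq: "?h = st (1 / a) \<circ> ((\<lambda>x. \<chi> i. if i = m then x $ m + x $ n else x $ i) \<circ> st a)"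
    using False assms by (auto simp: fun_eq_iff vec_eq_iff st_def)
  have "scales_measure_by (st (1 / a) \<circ> ((\<lambda>x. \<chi> i. if i = m then x $ m + x $ n else x $ i) \<circ> st a))
      (\<bar>1 / a\<bar> * (1 * \<bar>a\<bar>))"
    by (intro scales_measure_by_compose st scales_measure_by_unit_shear assms)
  then show ?thesis unfolding eq using False by (simp only: abs_mult[symmetric] mult_1) simp
qed

text \<open>Stretch coordinate \<open>m\<close> by \<open>a m\<close>, then add the multiples of the
  other coordinates by one shear each. Only the stretch changes volume.\<close>

lemma scales_measure_by_row_operation:
  fixes a :: "'n::finite \<Rightarrow> real"
  shows "scales_measure_by (\<lambda>x :: real^'n. \<chi> i. if i = m then \<Sum>j\<in>UNIV. a j * x $ j else x $ i) \<bar>a m\<bar>"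
proof -
  define sh where "sh J = (\<lambda>x :: real^'n. \<chi> i. if i = m then x $ m + (\<Sum>j\<in>J. a j * x $ j) else x $ i)" for J
  have sh: "scales_measure_by (sh J) 1" if "m \<notin> J" for J
    using finite[of J] that
  proof (induction J rule: finite_induct)
    case empty
    have "sh {} = id" by (auto simp: fun_eq_iff vec_eq_iff sh_def)
    then show ?case by (simp add: scales_measure_by_id)
  next
    case (insert n J)
    have eq: "sh (insert n J) = (\<lambda>x. \<chi> i. if i = m then x $ m + a n * x $ n else x $ i) \<circ> sh J"
      using insert by (auto simp: fun_eq_iff vec_eq_iff sh_def)
    show ?case
      unfolding eq using scales_measure_by_compose[OF scales_measure_by_shear[of m n "a n"] insert.IH] insert.prems
      by (simp only: mult_1 insert_iff de_Morgan_disj not_False_eq_True simp_thms)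
  qed
  have st: "scales_measure_by (\<lambda>x :: real^'n. \<chi> k. (if k = m then a m else 1) * x $ k) \<bar>a m\<bar>"
    using scales_measure_by_stretch[of "\<lambda>k. if k = m then a m else 1"] by (simp add: prod.delta)
  have "(\<lambda>x :: real^'n. \<chi> i. if i = m then \<Sum>j\<in>UNIV. a j * x $ j else x $ i) =
    sh (UNIV - {m}) \<circ> (\<lambda>x. \<chi> k. (if k = m then a m else 1) * x $ k)"
  proof -
    have "(\<Sum>j\<in>UNIV. a j * x $ j) = a m * x $ m + (\<Sum>j\<in>UNIV - {m}. a j * ((if j = m then a m else 1) * x $ j))"
      for x :: "real^'n"
      by (subst sum.remove[of UNIV m]) (auto intro!: sum.cong)
    then show ?thesis by (simp add: fun_eq_iff vec_eq_iff sh_def)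
  qed
  then show ?thesis
    using scales_measure_by_compose[OF sh st] by (simp only: mult_1 Diff_iff singletonI simp_thms)
qed

text \<open>The coordinates are replaced one at a time, highest rank first. Replacing coordinate
  \<open>m\<close> does not disturb the later replacements, since rows of smaller rank have entry 0
  in column \<open>m\<close>.\<close>

lemma scales_measure_by_lower_triangular:
  fixes L :: "real^'n^'n"
  assumes r: "inj r" and L: "lower_triangular r L"
  shows "scales_measure_by ((*v) L) \<bar>\<Prod>i\<in>UNIV. L $ i $ i\<bar>"
proof -
  define f where "f k = (\<lambda>x :: real^'n. \<chi> i. if r i < k then (L *v x) $ i else x $ i)" for k
  have *: "scales_measure_by (f k) \<bar>\<Prod>i | r i < k. L $ i $ i\<bar>" for k
  proof (induction k)
    case 0
    have "f 0 = id" by (auto simp: fun_eq_iff vec_eq_iff f_def)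
    then show ?case by (simp add: scales_measure_by_id)
  next
    case (Suc k)
    show ?case
    proof (cases "\<exists>m. r m = k")
      case False
      then have *: "r i < Suc k \<longleftrightarrow> r i < k" for i by (auto simp: less_Suc_eq)
      then have "f (Suc k) = f k" by (simp add: f_def)
      then show ?thesis using Suc * by simp
    next
      case True
      then obtain m where m: "r m = k" by blast
      have *: "r i < Suc k \<longleftrightarrow> i = m \<or> r i < k" for i
        using r m by (auto simp: less_Suc_eq inj_def)
      have "f (Suc k) = f k \<circ> (\<lambda>x. \<chi> i. if i = m then \<Sum>j\<in>UNIV. L $ m $ j * x $ j else x $ i)"
      proof -
        have "(\<Sum>j\<in>UNIV. L $ i $ j * (if j = m then y else x $ j)) = (\<Sum>j\<in>UNIV. L $ i $ j * x $ j)"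
          if "r i < k" for i y and x :: "real^'n"
          using that L m by (intro sum.cong) (auto simp: lower_triangular_def)
        then show ?thesis
          using m unfolding f_def fun_eq_iff vec_eq_iff *
          by (auto simp: matrix_vector_mult_def)
      qed
      moreover have "{i. r i < Suc k} = insert m {i. r i < k}" using * by auto
      ultimately show ?thesis
        using scales_measure_by_compose[OF Suc scales_measure_by_row_operation[of m "\<lambda>j. L $ m $ j"]] m
        by (simp add: abs_mult mult.commute del: o_apply)
    qed
  qed
  show ?thesis
  proof -
    have all: "r i < Suc (Max (range r))" for i by (simp add: less_Suc_eq_le)
    then have "{i. r i < Suc (Max (range r))} = UNIV" by blast
    moreover have "f (Suc (Max (range r))) = (*v) L"
      unfolding f_def using all by (simp only: if_True vec_lambda_eta)
    ultimately show ?thesis using *[of "Suc (Max (range r))"] by (simp only:)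
  qed
qed

section \<open>The largest inscribed ellipsoid\<close>

text \<open>\<open>L\<close> is the Cholesky factor of \<open>I + \<gamma> u u\<^sup>T\<close>. With the partial sums \<open>F\<close> and \<open>R\<close> below, both the
  diagonal product and the norm telescope along the order given by \<open>r\<close>.\<close>

lemma rank_one_cholesky:
  fixes u :: "real^'n" and r :: "'n \<Rightarrow> nat"
  assumes r: "bij_betw r UNIV {..<CARD('n)}" and u: "norm u = 1" and g: "\<gamma> \<ge> 0"
  obtains L where "lower_triangular r L" "\<And>i. 0 < L $ i $ i"
    "(\<Prod>i\<in>UNIV. L $ i $ i) = sqrt (1 + \<gamma>)"
    "\<And>v. (norm (transpose L *v v))\<^sup>2 = (norm v)\<^sup>2 + \<gamma> * (u \<bullet> v)\<^sup>2"
proof -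
  define F where "F k = 1 + \<gamma> * (\<Sum>i | r i < k. (u $ i)\<^sup>2)" for k
  have F1: "F k \<ge> 1" for k
    unfolding F_def using g by (simp add: sum_nonneg)
  then have Fpos: "F k > 0" for k by (smt (verit))
  have inj: "inj r" and img: "range r = {..<CARD('n)}"
    using r by (auto simp: bij_betw_def)
  have eqr: "r i = r j \<longleftrightarrow> i = j" for i j using inj by (auto simp: inj_def)
  have FSuc: "F (Suc (r j)) = F (r j) + \<gamma> * (u $ j)\<^sup>2" for j
  proof -
    have "{i. r i < Suc (r j)} = insert j {i. r i < r j}"
      using eqr by (auto simp: less_Suc_eq)
    then show ?thesis by (simp add: F_def algebra_simps)
  qed
  have lt: "r i < CARD('n)" for i using img by blast
  have Fend: "F CARD('n) = 1 + \<gamma>"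
    using u lt by (simp add: F_def norm_vec_def L2_set_def)
  define L :: "real^'n^'n" where "L = (\<chi> i j. if i = j then sqrt (F (Suc (r j)) / F (r j))
     else if r j < r i then \<gamma> * u $ i * u $ j / sqrt (F (Suc (r j)) * F (r j)) else 0)"
  show ?thesis
  proof (rule that)
    show "lower_triangular r L" by (auto simp: lower_triangular_def L_def)
    show "0 < L $ i $ i" for i using Fpos by (simp add: L_def)
    have "(\<Prod>i\<in>UNIV. L $ i $ i) = (\<Prod>i\<in>UNIV. (\<lambda>k. sqrt (F (Suc k)) / sqrt (F k)) (r i))"
      by (simp add: L_def real_sqrt_divide)
    also have "\<dots> = (\<Prod>k<CARD('n). sqrt (F (Suc k)) / sqrt (F k))"
      unfolding img[symmetric] by (simp add: prod.reindex inj)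
    also have "\<dots> = sqrt (F CARD('n)) / sqrt (F 0)"
      by (rule prod_lessThan_telescope) (use Fpos in \<open>auto simp: less_imp_neq[THEN not_sym]\<close>)
    also have "\<dots> = sqrt (1 + \<gamma>)" using Fend by (simp add: F_def)
    finally show "(\<Prod>i\<in>UNIV. L $ i $ i) = sqrt (1 + \<gamma>)" .
    fix v :: "real^'n"
    define R where "R k = (\<Sum>i | k \<le> r i. u $ i * v $ i)" for k
    have Rr: "R (r j) = R (Suc (r j)) + u $ j * v $ j" for j
    proof -
      have "{i. r j \<le> r i} = insert j {i. Suc (r j) \<le> r i}"
        using eqr by (auto simp: Suc_le_eq le_less)
      then show ?thesis by (simp add: R_def algebra_simps)
    qed
    have col: "(transpose L *v v) $ j =
        (F (Suc (r j)) * v $ j + \<gamma> * u $ j * R (Suc (r j))) / sqrt (F (Suc (r j)) * F (r j))" for j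
    proof -
      have "(transpose L *v v) $ j = (\<Sum>i\<in>UNIV. L $ i $ j * v $ i)"
        by (simp add: matrix_vector_mult_def transpose_def)
      also have "\<dots> = L $ j $ j * v $ j + (\<Sum>i\<in>UNIV - {j}. L $ i $ j * v $ i)"
        by (simp add: sum.remove)
      also have "(\<Sum>i\<in>UNIV - {j}. L $ i $ j * v $ i) = (\<Sum>i | Suc (r j) \<le> r i. L $ i $ j * v $ i)"
        by (rule sum.mono_neutral_right) (auto simp: L_def)
      also have "\<dots> = (\<Sum>i | Suc (r j) \<le> r i. (\<gamma> * u $ j / sqrt (F (Suc (r j)) * F (r j))) * (u $ i * v $ i))"
        by (rule sum.cong) (auto simp: L_def)
      also have "\<dots> = \<gamma> * u $ j / sqrt (F (Suc (r j)) * F (r j)) * R (Suc (r j))"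
        by (simp add: R_def sum_distrib_left)
      also have "L $ j $ j = F (Suc (r j)) / sqrt (F (Suc (r j)) * F (r j))"
        using Fpos[of "Suc (r j)"] Fpos[of "r j"]
        by (simp add: L_def real_sqrt_divide real_sqrt_mult real_div_sqrt field_simps)
      finally show ?thesis by (simp add: add_divide_distrib)
    qed
    have sq: "((transpose L *v v) $ j)\<^sup>2 =
        (v $ j)\<^sup>2 + \<gamma> * ((\<lambda>k. (R k)\<^sup>2 / F k - (R (Suc k))\<^sup>2 / F (Suc k)) (r j))" for j
    proof -
      have "((transpose L *v v) $ j)\<^sup>2 =
        (F (Suc (r j)) * v $ j + \<gamma> * u $ j * R (Suc (r j)))\<^sup>2 / (F (Suc (r j)) * F (r j))"
        unfolding col power_divide using Fpos by (simp add: less_imp_le)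
      also have "\<dots> = (v $ j)\<^sup>2 + \<gamma> * ((R (r j))\<^sup>2 / F (r j) - (R (Suc (r j)))\<^sup>2 / F (Suc (r j)))"
      proof -
        \<comment> \<open>The identity for one column: \<open>f\<close>, \<open>f'\<close> are
          consecutive values of \<open>F\<close>, \<open>w\<close> and \<open>x\<close> are the
          entries of \<open>u\<close> and \<open>v\<close>, and \<open>a\<close> is the tail sum
          \<open>R\<close> after that index.\<close>
        have "(f' * x + \<gamma> * w * a)\<^sup>2 / (f' * f) = x\<^sup>2 + \<gamma> * ((a + w * x)\<^sup>2 / f - a\<^sup>2 / f')"
          if "f > 0" "f' > 0" "f' = f + \<gamma> * w\<^sup>2" for f f' x w a :: real
        proof -
          have "(f' * x + \<gamma> * w * a)\<^sup>2 = (x\<^sup>2 + \<gamma> * ((a + w * x)\<^sup>2 / f - a\<^sup>2 / f')) * (f' * f)"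
          proof -
            have "(x\<^sup>2 + \<gamma> * ((a + w * x)\<^sup>2 / f - a\<^sup>2 / f')) * (f' * f) =
              x\<^sup>2 * f' * f + \<gamma> * ((a + w * x)\<^sup>2 * f' - a\<^sup>2 * f)"
              using that(1,2) by (simp add: field_simps)
            also have "\<dots> = (f' * x + \<gamma> * w * a)\<^sup>2"
              unfolding that(3) by algebra
            finally show ?thesis by simp
          qed
          then show ?thesis using that(1,2) by simp
        qed
        from this[OF Fpos Fpos FSuc] show ?thesis unfolding Rr .
      qed
      finally show ?thesis by simp
    qed
    have R0: "R 0 = u \<bullet> v" by (simp add: R_def inner_vec_def)
    have "{i. CARD('n) \<le> r i} = {}" using lt by (auto simp: not_le)
    then have Rend: "R CARD('n) = 0" unfolding R_def by (metis sum.empty)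
    have "(norm (transpose L *v v))\<^sup>2 = (\<Sum>j\<in>UNIV. ((transpose L *v v) $ j)\<^sup>2)"
      by (simp add: norm_vec_def L2_set_def sum_nonneg)
    also have "\<dots> = (\<Sum>j\<in>UNIV. (v $ j)\<^sup>2) +
       \<gamma> * (\<Sum>j\<in>UNIV. (\<lambda>k. (R k)\<^sup>2 / F k - (R (Suc k))\<^sup>2 / F (Suc k)) (r j))"
      unfolding sq by (simp add: sum.distrib sum_distrib_left)
    also have "(\<Sum>j\<in>UNIV. (\<lambda>k. (R k)\<^sup>2 / F k - (R (Suc k))\<^sup>2 / F (Suc k)) (r j)) =
       (\<Sum>k<CARD('n). (R k)\<^sup>2 / F k - (R (Suc k))\<^sup>2 / F (Suc k))"
      unfolding img[symmetric] by (simp add: sum.reindex inj)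
    also have "\<dots> = (u \<bullet> v)\<^sup>2"
      by (subst sum_lessThan_telescope'[of "\<lambda>k. (R k)\<^sup>2 / F k"]) (simp add: Rend R0, simp add: F_def)
    also have "(\<Sum>j\<in>UNIV. (v $ j)\<^sup>2) = (norm v)\<^sup>2"
      by (simp add: norm_vec_def L2_set_def sum_nonneg)
    finally show "(norm (transpose L *v v))\<^sup>2 = (norm v)\<^sup>2 + \<gamma> * (u \<bullet> v)\<^sup>2" .
  qed
qed

text \<open>With \<open>m = d - 1\<close> and \<open>q = \<rho> - 1\<close>, the product is
  \<open>1 + 2 * c * (1 - m / q)\<close> to first order in \<open>c\<close>, a gain because
  \<open>q > m\<close>. Bernoulli's inequality makes this quantitative.\<close>

lemma enlarged_ellipsoid_volume:
  fixes \<rho> :: real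
  assumes "\<rho> > real d" "d \<ge> 1"
  obtains c where "0 < c" "2 * c < \<rho> - 1" "(1 - 2 * c / (\<rho> - 1)) ^ (d - 1) * (1 + c)\<^sup>2 > 1"
proof -
  define m where "m = real (d - 1)"
  define q where "q = \<rho> - 1"
  \<comment> \<open>Chosen so that \<open>4 * c * (m + 1) = q - m\<close>, which gives both
    \<open>2 * c < q\<close> and \<open>2 * c * m < q - m\<close>.\<close>
  define c where "c = (q - m) / (4 * (m + 1))"
  have m: "m \<ge> 0" and qm: "q > m" using assms by (auto simp: m_def q_def)
  have c: "c > 0" using m qm by (simp add: c_def)
  have c2: "4 * c * (m + 1) = q - m"
  proof -
    have "c * (4 * (m + 1)) = q - m" using m unfolding c_def by simp
    then show ?thesis by (simp add: algebra_simps)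
  qed
  have cm: "c * m \<ge> 0" using c m by simp
  have c3: "4 * (c * m) + 4 * c = q - m" using c2 by (simp add: algebra_simps)
  have lt: "2 * c < q" using c3 cm m c by linarith
  have "1 - m * (2 * c / q) \<le> (1 - 2 * c / q) ^ (d - 1)"
    using Bernoulli_inequality[of "- (2 * c / q)" "d - 1"] lt c by (simp add: m_def)
  moreover have "1 + 2 * c \<le> (1 + c)\<^sup>2" by (simp add: power2_eq_square algebra_simps)
  moreover have "0 \<le> (1 - 2 * c / q) ^ (d - 1)" using lt c by simp
  ultimately have "(1 - m * (2 * c / q)) * (1 + 2 * c) \<le> (1 - 2 * c / q) ^ (d - 1) * (1 + c)\<^sup>2"
    using c by (intro mult_mono) auto
  moreover have "(1 - m * (2 * c / q)) * (1 + 2 * c) = 1 + 2 * c / q * (q - m - 2 * c * m)"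
    using lt c by (simp add: field_simps)
  moreover have "q - m - 2 * c * m > 0" using c3 cm c by linarith
  then have "2 * c / q * (q - m - 2 * c * m) > 0" using c lt by simp
  ultimately show ?thesis using that[of c] c lt by (simp add: q_def)
qed

text \<open>The ellipsoid has half-axis \<open>1 + c\<close> along \<open>u = y / \<bar>y\<bar>\<close> and half-axes \<open>sqrt A\<close> across, and is centred
  at \<open>c u\<close>; it touches the unit ball at \<open>-u\<close>, and \<open>A\<close> is the largest value for which it stays
  inside the hull. Containment is checked on support functions.\<close>

lemma ellipsoid_larger_than_ball:
  fixes y :: "real^'n" and r :: "'n \<Rightarrow> nat"
  assumes r: "bij_betw r UNIV {..<CARD('n)}" and y: "norm y > CARD('n)"
  obtains L c where "lower_triangular r L" "\<And>i. 0 < L $ i $ i" "1 < (\<Prod>i\<in>UNIV. L $ i $ i)"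
    "\<And>t. t \<in> cball 0 1 \<Longrightarrow> L *v t + c \<in> convex hull (insert y (cball 0 1))"
proof -
  define \<rho> where "\<rho> = norm y"
  have d1: "CARD('n) \<ge> 1" by (simp add: Suc_leI)
  obtain c where c: "0 < c" "2 * c < \<rho> - 1"
    and vol: "(1 - 2 * c / (\<rho> - 1)) ^ (CARD('n) - 1) * (1 + c)\<^sup>2 > 1"
    using enlarged_ellipsoid_volume[of "CARD('n)" \<rho>] y d1 unfolding \<rho>_def by blast
  define u where "u = (1 / \<rho>) *\<^sub>R y"
  have \<rho>: "\<rho> > 1" using y d1 unfolding \<rho>_def by linarith
  have u: "norm u = 1" and yu: "y = \<rho> *\<^sub>R u"
    using \<rho> by (auto simp: u_def \<rho>_def)
  define A where "A = 1 - 2 * c / (\<rho> - 1)"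
  have A: "0 < A" "A < 1" using c \<rho> by (auto simp: A_def)
  \<comment> \<open>With this value the matrix \<open>A (I + \<gamma> u u^T)\<close> has eigenvalue
    \<open>(1 + c)^2\<close> along \<open>u\<close> and \<open>A\<close> across, the squares of the
    wanted half-axes.\<close>
  define \<gamma> where "\<gamma> = (1 + c)\<^sup>2 / A - 1"
  have "A \<le> (1 + c)\<^sup>2" using A c by (smt (verit) one_le_power)
  then have g: "\<gamma> \<ge> 0" using A by (simp add: \<gamma>_def)
  have A\<gamma>: "A * (1 + \<gamma>) = (1 + c)\<^sup>2" using A by (simp add: \<gamma>_def)
  obtain L where L: "lower_triangular r L" "\<And>i. 0 < L $ i $ i"
    "(\<Prod>i\<in>UNIV. L $ i $ i) = sqrt (1 + \<gamma>)"
    "\<And>v. (norm (transpose L *v v))\<^sup>2 = (norm v)\<^sup>2 + \<gamma> * (u \<bullet> v)\<^sup>2"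
    using rank_one_cholesky[OF r u g] by blast
  define M where "M = sqrt A *\<^sub>R L"
  show ?thesis
  proof (rule that[of M "c *\<^sub>R u"])
    show "lower_triangular r M" using L(1) by (simp add: M_def lower_triangular_def)
    show "0 < M $ i $ i" for i using L(2) A by (simp add: M_def)
    have "1 < (1 + c)\<^sup>2 * A ^ (CARD('n) - 1)" using vol by (simp add: A_def mult.commute)
    also have "\<dots> = A ^ CARD('n) * (1 + \<gamma>)"
      unfolding A\<gamma>[symmetric] using d1 by (cases "CARD('n)") auto
    also have "\<dots> = (\<Prod>i\<in>UNIV. M $ i $ i)\<^sup>2"
      using A g by (simp add: M_def prod.distrib L(3) power_mult_distrib) (metis power_mult mult.commute real_sqrt_pow2 less_imp_le)
    finally have "1 < (\<Prod>i\<in>UNIV. M $ i $ i)\<^sup>2" .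
    moreover have "0 \<le> (\<Prod>i\<in>UNIV. M $ i $ i)"
      using \<open>\<And>i. 0 < M $ i $ i\<close> by (simp add: prod_nonneg less_imp_le)
    ultimately show "1 < (\<Prod>i\<in>UNIV. M $ i $ i)"
      by (smt (verit) power_le_one)
    fix t :: "real^'n" assume t: "t \<in> cball 0 1"
    define w where "w = M *v t + c *\<^sub>R u"
    define H where "H = convex hull (insert y (cball 0 (1::real)))"
    have "compact H" unfolding H_def by (intro compact_convex_hull compact_insert) simp
    then have clH: "closed H" by (rule compact_imp_closed)
    have cvH: "convex H" by (simp add: H_def)
    have sub: "insert y (cball 0 1) \<subseteq> H" unfolding H_def by (rule hull_subset)
    have "w \<in> H"
    proof (rule ccontr)
      assume "w \<notin> H"
      then obtain a b where ab: "a \<bullet> w < b" "\<And>x. x \<in> H \<Longrightarrow> a \<bullet> x > b"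
        using separating_hyperplane_closed_point[OF cvH clH] by metis
      define v where "v = - a"
      define n where "n = norm v"
      define p where "p = u \<bullet> v"
      have vx: "v \<bullet> x < v \<bullet> w" if "x \<in> H" for x using ab(2)[OF that] ab(1) by (simp add: v_def)
      have n0: "n \<ge> 0" by (simp add: n_def)
      \<comment> \<open>If \<open>v = 0\<close>, then \<open>1 / n\<close> is 0 and the point is the
        centre of the ball, still in \<open>H\<close>.\<close>
      have "(1 / n) *\<^sub>R v \<in> H" using sub by (auto simp: n_def)
      from vx[OF this] have w1: "n < v \<bullet> w" by (auto simp: n_def dot_square_norm power2_eq_square split: if_splits)
      have "y \<in> H" using sub by auto
      from vx[OF this] have w2: "\<rho> * p < v \<bullet> w" by (simp add: yu p_def inner_commute)
      have pn: "\<bar>p\<bar> \<le> n" using Cauchy_Schwarz_ineq2[of u v] u by (simp add: p_def n_def)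
      \<comment> \<open>\<open>sqrt Q + c * p\<close> is the support function of the ellipsoid in
        direction \<open>v\<close>. It must not exceed the larger of \<open>n\<close> (ball) and
        \<open>\<rho> * p\<close> (the point \<open>y\<close>), whence the case distinction
        below.\<close>
      define Q where "Q = A * n\<^sup>2 + ((1 + c)\<^sup>2 - A) * p\<^sup>2"
      have "v \<bullet> (M *v t) = (transpose M *v v) \<bullet> t"
        by (simp add: dot_lmul_matrix[symmetric])
      also have "\<dots> \<le> norm (transpose M *v v) * norm t" by (rule norm_cauchy_schwarz)
      also have "\<dots> \<le> norm (transpose M *v v)" using t by (simp add: mult_left_le)
      also have "\<dots> = sqrt Q"
      proof -
        have "transpose M *v v = sqrt A *\<^sub>R (transpose L *v v)"
          by (simp add: M_def transpose_def matrix_vector_mult_def vec_eq_iff sum_distrib_left mult.assoc)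
        then have "(norm (transpose M *v v))\<^sup>2 = A * (n\<^sup>2 + \<gamma> * p\<^sup>2)"
          using A L(4)[of v] by (simp add: power_mult_distrib n_def p_def)
        also have "\<dots> = Q"
          unfolding Q_def A\<gamma>[symmetric] by (simp add: algebra_simps)
        finally show ?thesis by (metis norm_ge_zero real_sqrt_unique)
      qed
      finally have wQ: "v \<bullet> w \<le> sqrt Q + c * p"
        by (simp add: w_def inner_add_right p_def inner_commute)
      have Aq: "A * (\<rho> - 1) = \<rho> - 1 - 2 * c" using \<rho> by (simp add: A_def field_simps)
      show False
      proof (cases "\<rho> * p \<le> n")
        case True
        \<comment> \<open>The factor \<open>n + p\<close> reflects the contact at \<open>-u\<close>;
          the factor \<open>n - \<rho> * p\<close> comes from the choice of \<open>A\<close>, for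
          which both support functions agree when \<open>n = \<rho> * p\<close>.\<close>
        have "0 \<le> 2 * c * (n + p) * (n - \<rho> * p)"
          using c True pn by (intro mult_nonneg_nonneg) auto
        also have "\<dots> = ((n - c * p)\<^sup>2 - Q) * (\<rho> - 1)"
        proof -
          have "((n - c * p)\<^sup>2 - Q) * (\<rho> - 1) =
            ((n - c * p)\<^sup>2 - (1 + c)\<^sup>2 * p\<^sup>2) * (\<rho> - 1) - (A * (\<rho> - 1)) * (n\<^sup>2 - p\<^sup>2)"
            unfolding Q_def by algebra
          also have "\<dots> = 2 * c * (n + p) * (n - \<rho> * p)" unfolding Aq by algebra
          finally show ?thesis by simp
        qed
        finally have "Q \<le> (n - c * p)\<^sup>2" using \<rho> by (simp add: zero_le_mult_iff)
        moreover have "0 \<le> n - c * p"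
        proof (cases "p \<le> 0")
          case True then show ?thesis using c n0 by (smt (verit) mult_nonneg_nonpos)
        next
          case False
          then have "c * p \<le> \<rho> * p" using c by (intro mult_right_mono) auto
          then show ?thesis using True by simp
        qed
        ultimately have "sqrt Q \<le> n - c * p" by (simp add: real_le_lsqrt)
        then show False using wQ w1 by simp
      next
        case False
        then have p0: "p > 0" using n0 \<rho> by (smt (verit) mult_nonneg_nonpos)
        have "n\<^sup>2 \<le> (\<rho> * p)\<^sup>2" using False n0 by (intro power_mono) auto
        then have "0 \<le> A * (\<rho> - 1) * ((\<rho> * p)\<^sup>2 - n\<^sup>2)"
          using A \<rho> by (intro mult_nonneg_nonneg) auto
        also have "\<dots> = (((\<rho> - c) * p)\<^sup>2 - Q) * (\<rho> - 1)"
        proof -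
          have "(((\<rho> - c) * p)\<^sup>2 - Q) * (\<rho> - 1) =
            (((\<rho> - c) * p)\<^sup>2 - (1 + c)\<^sup>2 * p\<^sup>2) * (\<rho> - 1) - (A * (\<rho> - 1)) * (n\<^sup>2 - p\<^sup>2)"
            unfolding Q_def by algebra
          also have "\<dots> = A * (\<rho> - 1) * ((\<rho> * p)\<^sup>2 - n\<^sup>2)" unfolding Aq by algebra
          finally show ?thesis by (rule sym)
        qed
        finally have "Q \<le> ((\<rho> - c) * p)\<^sup>2" using \<rho> by (simp add: zero_le_mult_iff)
        moreover have "0 \<le> (\<rho> - c) * p" using p0 c by simp
        ultimately have "sqrt Q \<le> (\<rho> - c) * p" by (simp add: real_le_lsqrt)
        then show False using wQ w2 by (simp add: algebra_simps)
      qed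
    qed
    then show "M *v t + c *\<^sub>R u \<in> convex hull (insert y (cball 0 1))" by (simp add: w_def H_def)
  qed
qed

text \<open>Zero diagonal entries are allowed: this keeps the set closed and makes a single point a
  degenerate ellipsoid.\<close>

definition inscribed :: "('n \<Rightarrow> nat) \<Rightarrow> (real^'n) set \<Rightarrow> ((real^'n^'n) \<times> (real^'n)) set" where
  "inscribed r K = {(L, b). lower_triangular r L \<and> (\<forall>i. 0 \<le> L $ i $ i) \<and>
     (\<forall>t\<in>cball 0 1. L *v t + b \<in> K)}"

lemma convex_inscribed:
  assumes "convex K" shows "convex (inscribed r K)"
proof (rule convexI)
  fix p q and u v :: real
  assume p: "p \<in> inscribed r K" and q: "q \<in> inscribed r K" and uv: "0 \<le> u" "0 \<le> v" "u + v = 1"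
  obtain L b M c where pq: "p = (L, b)" "q = (M, c)" by fastforce
  have "(u *\<^sub>R L + v *\<^sub>R M) *v t + (u *\<^sub>R b + v *\<^sub>R c) \<in> K" if t: "t \<in> cball 0 1" for t
  proof -
    have "u *\<^sub>R (L *v t + b) + v *\<^sub>R (M *v t + c) \<in> K"
      using convexD[OF assms _ _ uv] p q t pq by (auto simp: inscribed_def)
    then show ?thesis
      by (simp add: algebra_simps matrix_vector_mult_add_rdistrib scaleR_matrix_vector_assoc)
  qed
  then show "u *\<^sub>R p + v *\<^sub>R q \<in> inscribed r K"
    using p q uv by (auto simp: pq inscribed_def lower_triangular_def)
qed

lemma compact_inscribed:
  fixes K :: "(real^'n) set"
  assumes "compact K" shows "compact (inscribed r K)"
proof -
  have "inscribed r K = (\<Inter>i. \<Inter>j\<in>{j. r i < r j}. {p. fst p $ i $ j = 0}) \<inter> (\<Inter>i. {p. 0 \<le> fst p $ i $ i}) \<inter>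
     (\<Inter>t\<in>cball 0 1. (\<lambda>p. fst p *v t + snd p) -` K)"
    by (auto simp: inscribed_def lower_triangular_def)
  moreover
  have cl: "closed ((\<lambda>p. fst p *v t + snd p) -` K)" for t :: "real^'n"
    using compact_imp_closed[OF assms] unfolding matrix_vector_mult_def
    by (intro closed_vimage continuous_intros)
  have "closed (\<Inter>t\<in>cball (0 :: real^'n) 1. (\<lambda>p. fst p *v t + snd p) -` K)"
    by (intro closed_INT ballI cl)
  moreover
  have "closed {p :: (real^'n^'n) \<times> (real^'n). fst p $ i $ j = 0}"
    "closed {p :: (real^'n^'n) \<times> (real^'n). 0 \<le> fst p $ i $ j}" for i j
    by (rule closed_Collect_eq closed_Collect_le; intro continuous_intros)+
  then have "closed (\<Inter>i. \<Inter>j\<in>{j. r i < r j}. {p :: (real^'n^'n) \<times> (real^'n). fst p $ i $ j = 0})"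
    "closed (\<Inter>i. {p :: (real^'n^'n) \<times> (real^'n). 0 \<le> fst p $ i $ i})"
    by blast+
  ultimately have "closed (inscribed r K)" by (simp only: closed_Int)
  moreover have "bounded (inscribed r K)"
  proof -
    obtain B where B: "\<And>x. x \<in> K \<Longrightarrow> norm x \<le> B"
      using compact_imp_bounded[OF assms] by (auto simp: bounded_iff)
    have "norm p \<le> B + CARD('n) * (CARD('n) * (2 * B))" if "p \<in> inscribed r K" for p
    proof -
      obtain L b where p: "p = (L, b)" by fastforce
      have mem: "L *v t + b \<in> K" if "t \<in> cball 0 1" for t
        using \<open>p \<in> inscribed r K\<close> that by (auto simp: inscribed_def p)
      have b: "norm b \<le> B" using B[OF mem[of 0]] by simp
      \<comment> \<open>Column \<open>j\<close> is the difference of the two points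
        \<open>L *v axis j 1 + b\<close> and \<open>b\<close> of \<open>K\<close>.\<close>
      have "\<bar>L $ i $ j\<bar> \<le> 2 * B" for i j
      proof -
        have "L $ i $ j = (L *v axis j 1) $ i"
          by (simp add: matrix_vector_mult_basis column_def)
        then have "\<bar>L $ i $ j\<bar> \<le> norm (L *v axis j 1)"
          by (simp add: component_le_norm_cart)
        also have "\<dots> \<le> norm (L *v axis j 1 + b) + norm b"
          by (metis add_diff_cancel norm_triangle_ineq4)
        also have "\<dots> \<le> 2 * B" using B[OF mem[of "axis j 1"]] b by simp
        finally show ?thesis .
      qed
      then have "norm (L $ i) \<le> CARD('n) * (2 * B)" for i
        using norm_le_l1_cart[of "L $ i"] sum_bounded_above[of UNIV "\<lambda>j. \<bar>L $ i $ j\<bar>" "2 * B"] by fastforce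
      then have "norm L \<le> CARD('n) * (CARD('n) * (2 * B))"
        using L2_set_le_sum[of UNIV "\<lambda>i. norm (L $ i)"]
          sum_bounded_above[of UNIV "\<lambda>i. norm (L $ i)" "CARD('n) * (2 * B)"]
        by (fastforce simp: norm_vec_def)
      then show ?thesis
        using b norm_Pair_le[of L b] by (simp add: p)
    qed
    then show ?thesis unfolding bounded_iff by blast
  qed
  ultimately show ?thesis by (simp add: compact_eq_bounded_closed)
qed

lemma lower_triangular_mult:
  fixes L M :: "real^'n^'n"
  assumes r: "inj r" and L: "lower_triangular r L" and M: "lower_triangular r M"
  shows "lower_triangular r (L ** M)" and "(L ** M) $ i $ i = L $ i $ i * M $ i $ i"
proof -
  show "lower_triangular r (L ** M)"
    unfolding lower_triangular_def matrix_matrix_mult_def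
  proof (clarsimp intro!: sum.neutral)
    fix i j k assume "r i < r j" "M $ k $ j \<noteq> 0"
    with L M show "L $ i $ k = 0"
      unfolding lower_triangular_def by (meson linorder_not_less order_less_le_trans)
  qed
  have "L $ i $ k * M $ k $ i = 0" if "k \<noteq> i" for k
  proof -
    have "r k \<noteq> r i" using r that by (auto simp: inj_def)
    then show ?thesis using L M by (auto simp: lower_triangular_def neq_iff)
  qed
  then have "(\<Sum>k\<in>UNIV - {i}. L $ i $ k * M $ k $ i) = 0"
    by (intro sum.neutral) blast
  then show "(L ** M) $ i $ i = L $ i $ i * M $ i $ i"
    by (simp add: matrix_matrix_mult_def sum.remove[of UNIV i])
qed

lemma measure_ellipsoid:
  fixes L :: "real^'n^'n"
  assumes "inj r" "lower_triangular r L" "\<And>i. 0 \<le> L $ i $ i" "0 \<le> s"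
  shows "(\<lambda>t. L *v t + b) ` cball 0 s \<in> lmeasurable"
    and "measure lebesgue ((\<lambda>t. L *v t + b) ` cball 0 s) =
      (\<Prod>i\<in>UNIV. L $ i $ i) * (unit_ball_vol (real CARD('n)) * s ^ CARD('n))"
proof -
  have eq: "(\<lambda>t. L *v t + b) ` cball 0 s = (+) b ` ((*v) L ` cball 0 s)"
    by (simp add: image_image add.commute)
  have "cball (0 :: real^'n) s \<in> lmeasurable" by simp
  then have *: "(*v) L ` cball 0 s \<in> lmeasurable"
    "measure lebesgue ((*v) L ` cball 0 s) = \<bar>\<Prod>i\<in>UNIV. L $ i $ i\<bar> * measure lebesgue (cball (0 :: real^'n) s)"
    using scales_measure_by_lower_triangular[OF assms(1,2)] by (simp_all add: scales_measure_by_def)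
  show "(\<lambda>t. L *v t + b) ` cball 0 s \<in> lmeasurable"
    unfolding eq using *(1) by (rule measurable_translation)
  show "measure lebesgue ((\<lambda>t. L *v t + b) ` cball 0 s) =
      (\<Prod>i\<in>UNIV. L $ i $ i) * (unit_ball_vol (real CARD('n)) * s ^ CARD('n))"
    unfolding eq measure_translation using *(2) assms by (simp add: content_cball prod_nonneg)
qed

text \<open>The diagonal product attains its maximum on the compact set of inscribed parameters. If
  a point \<open>L *v y + b\<close> of \<open>K\<close> had \<open>norm y > CARD('n)\<close>, the
  larger ellipsoid in the hull of \<open>y\<close> and the unit ball, carried over by
  \<open>L\<close> and \<open>b\<close>, would beat the maximum. So \<open>K\<close> lies in the
  \<open>CARD('n)\<close>-fold enlargement of the ellipsoid.\<close>

lemma inscribed_ellipsoid_volume: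
  fixes K :: "(real^'n) set"
  assumes r: "bij_betw r UNIV {..<CARD('n)}" and K: "compact K" "convex K" "0 < measure lebesgue K"
  obtains L b where "(L, b) \<in> inscribed r K"
    "measure lebesgue K \<le> (\<Prod>i\<in>UNIV. L $ i $ i) * (unit_ball_vol (real CARD('n)) * real CARD('n) ^ CARD('n))"
proof -
  have inj: "inj r" using r by (simp add: bij_betw_def)
  \<comment> \<open>A small ball inside \<open>K\<close> shows that the maximum is positive, so the
    optimal ellipsoid is not degenerate.\<close>
  have "interior K \<noteq> {}"
    using K negligible_convex_interior negligible_imp_measure0 by fastforce
  then obtain x e where e: "e > 0" "cball x e \<subseteq> K" by (metis all_not_in_conv mem_interior_cball)
  have "e *\<^sub>R t + x \<in> K" if "norm t \<le> 1" for t
  proof -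
    have "e *\<^sub>R t + x \<in> cball x e" using e(1) that by (simp add: dist_norm)
    then show ?thesis using e(2) by blast
  qed
  then have I: "(e *\<^sub>R mat 1, x) \<in> inscribed r K"
  proof -
    have "(e *\<^sub>R mat 1) *v t = e *\<^sub>R t" for t :: "real^'n"
      by (simp add: scaleR_matrix_vector_assoc[symmetric])
    then show ?thesis
      using \<open>\<And>t. norm t \<le> 1 \<Longrightarrow> e *\<^sub>R t + x \<in> K\<close> e(1)
      by (auto simp: inscribed_def lower_triangular_def mat_def)
  qed
  have "continuous_on (inscribed r K) (\<lambda>p. \<Prod>i\<in>UNIV. fst p $ i $ i)"
    by (intro continuous_intros)
  then obtain p where p: "p \<in> inscribed r K"
    and max: "\<And>q. q \<in> inscribed r K \<Longrightarrow> (\<Prod>i\<in>UNIV. fst q $ i $ i) \<le> (\<Prod>i\<in>UNIV. fst p $ i $ i)"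
    using continuous_attains_sup[OF compact_inscribed[OF K(1)]] I by blast
  obtain L b where Lb: "p = (L, b)" by fastforce
  have L: "lower_triangular r L" "\<And>i. 0 \<le> L $ i $ i"
    and sub: "\<And>t. t \<in> cball 0 1 \<Longrightarrow> L *v t + b \<in> K"
    using p by (auto simp: Lb inscribed_def)
  have "0 < e ^ CARD('n)" using e by simp
  also have "\<dots> \<le> (\<Prod>i\<in>UNIV. L $ i $ i)" using max[OF I] by (simp add: Lb mat_def)
  finally have pos: "0 < (\<Prod>i\<in>UNIV. L $ i $ i)" .
  have surj: "surj ((*v) L)"
  proof (rule ccontr)
    assume "\<not> surj ((*v) L)"
    then have "\<not> inj ((*v) L)" using linear_injective_imp_surjective[OF matrix_vector_mul_linear[of L]] by blast
    then have "negligible ((*v) L ` cball 0 1)"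
      by (simp add: negligible_linear_singular_image)
    then have "negligible ((\<lambda>t. L *v t + 0) ` cball 0 1)" by simp
    then have "measure lebesgue ((\<lambda>t. L *v t + 0) ` cball 0 1) = 0"
      by (rule negligible_imp_measure0)
    moreover have "(\<Prod>i\<in>UNIV. L $ i $ i) * (unit_ball_vol (real CARD('n)) * 1 ^ CARD('n)) > 0"
      using pos by (intro mult_pos_pos) auto
    ultimately show False
      unfolding measure_ellipsoid(2)[OF inj L zero_le_one] by linarith
  qed
  have "K \<subseteq> (\<lambda>t. L *v t + b) ` cball 0 (real CARD('n))"
  proof
    fix z assume z: "z \<in> K"
    obtain y where y: "z = L *v y + b" using surjD[OF surj, of "z - b"] by (auto simp: algebra_simps)
    have "norm y \<le> CARD('n)"
    proof (rule ccontr)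
      assume "\<not> norm y \<le> CARD('n)"
      then have ny: "norm y > CARD('n)" by simp
      obtain M c where M: "lower_triangular r M" "\<And>i. 0 < M $ i $ i" "1 < (\<Prod>i\<in>UNIV. M $ i $ i)"
        and Mc: "\<And>t. t \<in> cball 0 1 \<Longrightarrow> M *v t + c \<in> convex hull (insert y (cball 0 1))"
        using ellipsoid_larger_than_ball[OF r ny] by blast
      have hull: "convex hull (insert y (cball 0 1)) \<subseteq> (\<lambda>t. L *v t + b) -` K"
      proof (rule hull_minimal)
        show "insert y (cball 0 1) \<subseteq> (\<lambda>t. L *v t + b) -` K" using z y sub by auto
        have "(\<lambda>t. L *v t + b) -` K = (*v) L -` ((+) (- b) ` K)"
          by (force simp: image_iff)
        then show "convex ((\<lambda>t. L *v t + b) -` K)"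
          using K(2) by (simp add: convex_linear_vimage convex_translation)
      qed
      have "(L ** M) *v t + (L *v c + b) \<in> K" if "t \<in> cball 0 1" for t
        using hull Mc[OF that]
        by (auto simp: matrix_vector_mul_assoc[symmetric] matrix_vector_right_distrib add.assoc)
      then have "(L ** M, L *v c + b) \<in> inscribed r K"
        using lower_triangular_mult[OF inj L(1) M(1)] L(2) M(2)
        by (auto simp: inscribed_def less_imp_le)
      from max[OF this] have "(\<Prod>i\<in>UNIV. L $ i $ i) * (\<Prod>i\<in>UNIV. M $ i $ i) \<le> (\<Prod>i\<in>UNIV. L $ i $ i)"
        by (simp add: Lb lower_triangular_mult(2)[OF inj L(1) M(1)] prod.distrib)
      then show False using pos M(3) by simp
    qed
    then show "z \<in> (\<lambda>t. L *v t + b) ` cball 0 (real CARD('n))" using y by auto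
  qed
  then have "measure lebesgue K \<le> measure lebesgue ((\<lambda>t. L *v t + b) ` cball 0 (real CARD('n)))"
    using measure_ellipsoid(1)[OF inj L, of "real CARD('n)" b] lmeasurable_compact[OF K(1)]
    by (intro measure_mono_fmeasurable) auto
  then show ?thesis
    using that[of L b] p measure_ellipsoid(2)[OF inj L, of "real CARD('n)" b] by (simp add: Lb)
qed

section \<open>Helly's theorem for ellipsoids\<close>

text \<open>Repetitions in the family do no harm: a collection of members is indexed injectively by
  a set \<open>J\<close> of the same cardinality.\<close>

lemma Helly_indexed:
  fixes S :: "'i \<Rightarrow> 'a::euclidean_space set"
  assumes "finite I" "\<And>i. i \<in> I \<Longrightarrow> convex (S i)"
    and ne: "\<And>J. J \<subseteq> I \<Longrightarrow> card J \<le> DIM('a) + 1 \<Longrightarrow> (\<Inter>i\<in>J. S i) \<noteq> {}"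
  shows "(\<Inter>i\<in>I. S i) \<noteq> {}"
proof -
  have sub: "\<Inter>t \<noteq> {}" if t: "t \<subseteq> S ` I" "card t \<le> DIM('a) + 1" for t
  proof -
    obtain J where "J \<subseteq> I" "inj_on S J" "t = S ` J"
      using subset_image_inj[THEN iffD1, OF t(1)] by blast
    then show ?thesis using ne[of J] t(2) by (simp add: card_image)
  qed
  show ?thesis
  proof (cases "card (S ` I) \<le> DIM('a) + 1")
    case True
    then show ?thesis using sub by blast
  next
    case False
    show ?thesis
    proof (rule Helly)
      show "DIM('a) + 1 \<le> card (S ` I)" using False by simp
      show "\<forall>s\<in>S ` I. convex s" using assms(2) by blast
      show "\<Inter>t \<noteq> {}" if "t \<subseteq> S ` I" "card t = DIM('a) + 1" for t
        using sub[of t] that by simp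
    qed
  qed
qed

text \<open>Lets unordered pairs index the coordinates of a Euclidean space.\<close>

instance uprod :: (finite) finite
  by standard simp

lemma DIM_lower_triangular_parameters:
  "DIM((real^'n uprod) \<times> (real^'n)) = CARD('n::finite) * (CARD('n) + 3) div 2"
proof -
  have "even (CARD('n) * (CARD('n) + 1))" by simp
  moreover have "CARD('n) * (CARD('n) + 3) = CARD('n) * (CARD('n) + 1) + 2 * CARD('n)"
    by (simp add: algebra_simps)
  ultimately show ?thesis by (simp add: card_UNIV_uprod)
qed

text \<open>Entry \<open>(i, j)\<close> of a lower triangular matrix is stored at the unordered pair \<open>{i, j}\<close>, so that the
  parameter space is a type of the right dimension.\<close>

lemma Helly_lower_triangular:
  fixes S :: "'i \<Rightarrow> ((real^'n^'n) \<times> (real^'n)) set"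
  assumes r: "inj r" and I: "finite I" "\<And>i. i \<in> I \<Longrightarrow> convex (S i)"
    and low: "\<And>i L b. i \<in> I \<Longrightarrow> (L, b) \<in> S i \<Longrightarrow> lower_triangular r L"
    and ne: "\<And>J. J \<subseteq> I \<Longrightarrow> card J \<le> CARD('n) * (CARD('n) + 3) div 2 + 1 \<Longrightarrow> (\<Inter>i\<in>J. S i) \<noteq> {}"
  shows "(\<Inter>i\<in>I. S i) \<noteq> {}"
proof -
  define \<phi> :: "(real^'n uprod) \<times> (real^'n) \<Rightarrow> (real^'n^'n) \<times> (real^'n)"
    where "\<phi> p = ((\<chi> i j. if r j \<le> r i then fst p $ Upair i j else 0), snd p)" for p
  have lin: "linear \<phi>"
    by (rule linearI) (auto simp: \<phi>_def vec_eq_iff)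
  have onto: "(L, b) \<in> range \<phi>" if L: "lower_triangular r L" for L b
  proof -
    \<comment> \<open>Decodes an unordered pair with the index of larger rank first; the order is
      unique because \<open>r\<close> is injective.\<close>
    define e where "e u = (SOME p. u = Upair (fst p) (snd p) \<and> r (snd p) \<le> r (fst p))" for u
    have e: "e (Upair i j) = (i, j)" if "r j \<le> r i" for i j
      unfolding e_def using that r by (intro some_equality) (auto simp: inj_def)
    have "\<phi> (\<chi> u. L $ fst (e u) $ snd (e u), b) = (L, b)"
      using L e by (auto simp: \<phi>_def vec_eq_iff lower_triangular_def not_le)
    then show ?thesis by (metis rangeI)
  qed
  have "(\<Inter>i\<in>I. \<phi> -` S i) \<noteq> {}"
  proof (rule Helly_indexed[OF I(1)])
    show "convex (\<phi> -` S i)" if "i \<in> I" for i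
      using I(2)[OF that] lin by (simp add: convex_linear_vimage)
    fix J assume J: "J \<subseteq> I" "card J \<le> DIM((real^'n uprod) \<times> (real^'n)) + 1"
    then obtain L b where Lb: "(L, b) \<in> (\<Inter>i\<in>J. S i)"
      using ne[OF J(1)] unfolding DIM_lower_triangular_parameters by (metis all_not_in_conv surj_pair)
    show "(\<Inter>i\<in>J. \<phi> -` S i) \<noteq> {}"
    \<comment> \<open>For empty \<open>J\<close> nothing forces \<open>L\<close> to be triangular,
      but the intersection is then the whole parameter space.\<close>
    proof (cases "J = {}")
      case False
      then have "lower_triangular r L" using Lb low J(1) by blast
      then obtain p where "(L, b) = \<phi> p" using onto by blast
      then show ?thesis using Lb by auto
    qed simp
  qed
  then show ?thesis by auto
qed

definition large_matrices :: "('n \<Rightarrow> nat) \<Rightarrow> real \<Rightarrow> ((real^'n^'n) \<times> (real^'n)) set" where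
  "large_matrices r c = {(L, b). lower_triangular r L \<and> (\<forall>i. 0 \<le> L $ i $ i) \<and> c \<le> (\<Prod>i\<in>UNIV. L $ i $ i)}"

text \<open>Weighted arithmetic-geometric means in each factor, multiplied together and combined
  with \<open>c = c powr u * c powr v\<close>. Positivity of \<open>c\<close> makes all factors
  positive.\<close>

lemma prod_convex_combination_ge:
  fixes a b :: "'i \<Rightarrow> real"
  assumes "finite I" "0 < c" "\<And>i. i \<in> I \<Longrightarrow> 0 \<le> a i" "\<And>i. i \<in> I \<Longrightarrow> 0 \<le> b i"
    and "c \<le> prod a I" "c \<le> prod b I" and uv: "0 \<le> u" "0 \<le> v" "u + v = 1"
  shows "c \<le> (\<Prod>i\<in>I. u * a i + v * b i)"
proof -
  have "prod a I \<noteq> 0" "prod b I \<noteq> 0" using assms(2,5,6) by auto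
  then have "\<forall>i\<in>I. a i \<noteq> 0 \<and> b i \<noteq> 0" using assms(1) by (simp add: prod_zero_iff)
  then have pos: "0 < a i" "0 < b i" if "i \<in> I" for i
    using that assms(3,4)[OF that] by (auto simp: less_le)
  have "c = c powr u * c powr v"
    using assms by (simp add: powr_add[symmetric])
  also have "\<dots> \<le> prod a I powr u * prod b I powr v"
    using assms by (intro mult_mono powr_mono2) auto
  also have "\<dots> = (\<Prod>i\<in>I. a i powr u * b i powr v)"
    using assms(3,4) by (simp add: prod_powr_distrib prod.distrib)
  also have "\<dots> \<le> (\<Prod>i\<in>I. u * a i + v * b i)"
    using pos uv by (intro prod_mono) (auto intro: Youngs_inequality_0)
  finally show ?thesis .
qed

lemma convex_large_matrices:
  assumes "0 < c" shows "convex (large_matrices r c)"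
proof (rule convexI)
  fix p q and u v :: real
  assume pq: "p \<in> large_matrices r c" "q \<in> large_matrices r c" and uv: "0 \<le> u" "0 \<le> v" "u + v = 1"
  then show "u *\<^sub>R p + v *\<^sub>R q \<in> large_matrices r c"
    using prod_convex_combination_ge[OF finite assms _ _ _ _ uv,
        where a = "\<lambda>i. fst p $ i $ i" and b = "\<lambda>i. fst q $ i $ i"]
    by (cases p; cases q) (simp add: large_matrices_def lower_triangular_def)
qed

lemma closed_large_matrices:
  "closed (large_matrices r c :: ((real^'n^'n) \<times> (real^'n)) set)"
proof -
  have "large_matrices r c = (\<Inter>i. \<Inter>j\<in>{j. r i < r j}. {p. fst p $ i $ j = 0}) \<inter> (\<Inter>i. {p. 0 \<le> fst p $ i $ i}) \<inter>
     {p :: (real^'n^'n) \<times> (real^'n). c \<le> (\<Prod>i\<in>UNIV. fst p $ i $ i)}"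
    by (auto simp: large_matrices_def lower_triangular_def)
  moreover
  have "closed {p :: (real^'n^'n) \<times> (real^'n). fst p $ i $ j = 0}"
    "closed {p :: (real^'n^'n) \<times> (real^'n). 0 \<le> fst p $ i $ j}"
    "closed {p :: (real^'n^'n) \<times> (real^'n). c \<le> (\<Prod>i\<in>UNIV. fst p $ i $ i)}" for i j
    by (rule closed_Collect_eq closed_Collect_le; intro continuous_intros)+
  then have "closed (\<Inter>i. \<Inter>j\<in>{j. r i < r j}. {p :: (real^'n^'n) \<times> (real^'n). fst p $ i $ j = 0})"
    "closed (\<Inter>i. {p :: (real^'n^'n) \<times> (real^'n). 0 \<le> fst p $ i $ i})"
    "closed {p :: (real^'n^'n) \<times> (real^'n). c \<le> (\<Prod>i\<in>UNIV. fst p $ i $ i)}"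
    by blast+
  ultimately show ?thesis by (simp only: closed_Int)
qed

lemma inscribed_mono: "K \<subseteq> M \<Longrightarrow> inscribed r K \<subseteq> inscribed r M"
  by (auto simp: inscribed_def)

lemma inscribed_center: "(L, b) \<in> inscribed r K \<Longrightarrow> b \<in> K"
  by (auto simp: inscribed_def dest!: bspec[where x = 0])

theorem Helly_ellipsoids:
  fixes H :: "'i \<Rightarrow> (real^'n) set"
  assumes r: "inj r" and c: "0 < c" and Y: "Y \<noteq> {}"
    and H: "\<And>y. y \<in> Y \<Longrightarrow> compact (H y)" "\<And>y. y \<in> Y \<Longrightarrow> convex (H y)"
    and few: "\<And>Z. Z \<subseteq> Y \<Longrightarrow> finite Z \<Longrightarrow> card Z \<le> CARD('n) * (CARD('n) + 3) div 2 \<Longrightarrow>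
      large_matrices r c \<inter> (\<Inter>y\<in>Z. inscribed r (H y)) \<noteq> {}"
  shows "large_matrices r c \<inter> (\<Inter>y\<in>Y. inscribed r (H y)) \<noteq> {}"
proof -
  define N where "N = CARD('n) * (CARD('n) + 3) div 2"
  \<comment> \<open>Ensures that \<open>few\<close> covers the \<open>CARD('n) + 1\<close> hulls
    needed for Helly's theorem on points.\<close>
  have "2 * (CARD('n) + 1) \<le> CARD('n) * (CARD('n) + 3)"
  proof -
    obtain k where "CARD('n) = Suc k" by (metis finite_UNIV_card_ge_0 finite gr0_implies_Suc)
    then show ?thesis by simp
  qed
  then have N: "CARD('n) + 1 \<le> N" by (simp add: N_def)
  have points: "(\<Inter>y\<in>Z. H y) \<noteq> {}" if "Z \<subseteq> Y" "finite Z" for Z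
  proof (rule Helly_indexed[OF that(2)])
    fix W assume W: "W \<subseteq> Z" "card W \<le> DIM(real^'n) + 1"
    then have "card W \<le> N" using N by simp
    then have "large_matrices r c \<inter> (\<Inter>y\<in>W. inscribed r (H y)) \<noteq> {}"
      unfolding N_def using W that by (intro few) (auto intro: finite_subset)
    then obtain L b where "(L, b) \<in> (\<Inter>y\<in>W. inscribed r (H y))" by fast
    then have "b \<in> (\<Inter>y\<in>W. H y)" using inscribed_center by blast
    then show "(\<Inter>y\<in>W. H y) \<noteq> {}" by blast
  qed (use that H in auto)
  have finitely_many: "large_matrices r c \<inter> (\<Inter>y\<in>Z. inscribed r (H y)) \<noteq> {}" if Z: "Z \<subseteq> Y" "finite Z" for Z
  proof -
    \<comment> \<open>\<open>None\<close> stands for the volume constraint, \<open>Some y\<close>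
      for containment in the hull \<open>H y\<close>.\<close>
    define S where "S = case_option (large_matrices r c) (\<lambda>y. inscribed r (H y))"
    have "(\<Inter>i\<in>insert None (Some ` Z). S i) \<noteq> {}"
    proof (rule Helly_lower_triangular[OF r])
      show "finite (insert None (Some ` Z))" using Z by simp
      show "convex (S i)" if "i \<in> insert None (Some ` Z)" for i
        using that Z H(2) c by (auto simp: S_def convex_large_matrices convex_inscribed)
      show "lower_triangular r L" if "i \<in> insert None (Some ` Z)" "(L, b) \<in> S i" for i L b
        using that by (auto simp: S_def large_matrices_def inscribed_def)
      fix J assume J: "J \<subseteq> insert None (Some ` Z)"
        "card J \<le> CARD('n) * (CARD('n) + 3) div 2 + 1"
      define W where "W = {y. Some y \<in> J}"
      have W: "W \<subseteq> Z" "finite W" using J Z by (auto simp: W_def intro: finite_subset)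
      have JW: "J - {None} = Some ` W"
        using J(1) by (auto simp: W_def image_iff)
      show "(\<Inter>i\<in>J. S i) \<noteq> {}"
      proof (cases "None \<in> J")
        case True
        then have J': "J = insert None (Some ` W)" using JW by auto
        \<comment> \<open>\<open>None\<close> takes one of the \<open>N + 1\<close> places, leaving
          at most \<open>N\<close> hulls, as \<open>few\<close> requires.\<close>
        then have "card J = card W + 1" using W by (simp add: card_image)
        then have "large_matrices r c \<inter> (\<Inter>y\<in>W. inscribed r (H y)) \<noteq> {}"
          using W Z J(2) by (intro few) auto
        then show ?thesis by (simp add: J' S_def image_image)
      next
        case False
        then have J': "J = Some ` W" using JW by auto
        obtain x where "x \<in> (\<Inter>y\<in>W. H y)" using points[of W] W Z by blast
        then have "(0, x) \<in> (\<Inter>i\<in>J. S i)"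
          by (auto simp: J' S_def inscribed_def lower_triangular_def)
        then show ?thesis by blast
      qed
    qed
    then show ?thesis by (simp add: S_def image_image)
  qed
  obtain y0 where y0: "y0 \<in> Y" using Y by blast
  \<comment> \<open>In \<open>large_matrices\<close> the centre is unrestricted; one fixed hull
    supplies the compactness needed to pass from finite subsets to all of \<open>Y\<close>.\<close>
  have "(large_matrices r c \<inter> inscribed r (H y0)) \<inter> (\<Inter>y\<in>Y. inscribed r (H y)) \<noteq> {}"
  proof (rule compact_imp_fip_image)
    show "compact (large_matrices r c \<inter> inscribed r (H y0))"
      using closed_large_matrices compact_inscribed[OF H(1)[OF y0]] by (rule closed_Int_compact)
    show "closed (inscribed r (H y))" if "y \<in> Y" for y
      using compact_inscribed[OF H(1)[OF that]] by (rule compact_imp_closed)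
    show "(large_matrices r c \<inter> inscribed r (H y0)) \<inter> (\<Inter>y\<in>Z. inscribed r (H y)) \<noteq> {}"
      if "finite Z" "Z \<subseteq> Y" for Z
      using finitely_many[of "insert y0 Z"] that y0 by (simp add: Int_assoc)
  qed
  then show ?thesis by blast
qed

section \<open>Krasnoselskii's argument\<close>

text \<open>If \<open>z\<close> does not see \<open>y\<close>, take a point \<open>v\<close> outside \<open>K\<close> on the segment from \<open>z\<close> to \<open>y\<close> such that
  moving from \<open>v\<close> towards \<open>z\<close> does not at first decrease the distance to \<open>K\<close>, and let \<open>q\<close> be a point of \<open>K\<close>
  nearest to \<open>v\<close>. Everything that sees \<open>q\<close> lies in the half-space through \<open>q\<close> facing away
  from \<open>v\<close>, but \<open>z\<close> does not.\<close>

lemma in_kernel_if_in_hulls: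
  fixes K :: "'a::euclidean_space set"
  assumes K: "closed K" and y: "y \<in> K"
    and z: "\<And>q. q \<in> K \<Longrightarrow> z \<in> convex hull {x. sees K x q}"
  shows "sees K z y"
proof (rule ccontr)
  assume "\<not> sees K z y"
  define f where "f t = z + t *\<^sub>R (y - z)" for t :: real
  define g where "g t = infdist (f t) K" for t
  have cont: "continuous_on A g" for A
    unfolding g_def f_def by (intro continuous_intros)
  have "closed_segment z y = f ` {0..1}"
    by (auto simp: closed_segment_image_interval f_def algebra_simps)
  with \<open>\<not> sees K z y\<close> have "\<not> f ` {0..1} \<subseteq> K" by (simp add: sees_def)
  then obtain t0 where t0: "0 \<le> t0" "t0 \<le> 1" "f t0 \<notin> K"
    unfolding image_subset_iff by (meson atLeastAtMost_iff)
  have g0: "g t0 > 0"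
    unfolding g_def using t0(3) K y by (intro infdist_pos_not_in_closed) auto
  \<comment> \<open>Its least element \<open>t1\<close> is the first parameter after
    \<open>t0\<close> at which the distance to \<open>K\<close> has dropped to half. It exists
    because the distance is 0 at \<open>y\<close>, and \<open>f t1\<close> is still outside
    \<open>K\<close>.\<close>
  define T where "T = {t0..1} \<inter> {t. g t \<le> g t0 / 2}"
  have "closed {t. g t \<le> g t0 / 2}"
    by (intro closed_Collect_le cont continuous_on_const)
  then have "compact T" unfolding T_def by (intro compact_Int_closed) auto
  moreover have "1 \<in> T" using t0 g0 y by (simp add: T_def g_def f_def)
  ultimately obtain t1 where t1: "t1 \<in> T" and min: "\<And>t. t \<in> T \<Longrightarrow> t1 \<le> t"
    using compact_attains_inf[of T] by blast
  have bnd: "t0 \<le> t1" "t1 \<le> 1" "g t1 \<le> g t0 / 2" using t1 by (auto simp: T_def)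
  then have "t1 \<noteq> t0" using g0 by auto
  then have less: "t0 < t1" using bnd by simp
  obtain s where s: "t0 \<le> s" "s \<le> t1" "g s = g t0 / 2"
    using IVT2'[of g t1 "g t0 / 2" t0] bnd g0 cont by auto
  then have "t1 \<le> s" using min[of s] bnd by (simp add: T_def)
  then have g1: "g t1 = g t0 / 2" using s by simp
  have before: "g t1 \<le> g s" if "t0 \<le> s" "s \<le> t1" for s
    using min[of s] that bnd g1 by (cases "s = t1") (force simp: T_def)+
  define v where "v = f t1"
  obtain q where q: "q \<in> K" "infdist v K = dist v q"
    using infdist_attains_inf[OF K, of v] y by blast
  have vq: "v \<noteq> q" using g1 g0 q by (auto simp: g_def v_def)
  \<comment> \<open>Otherwise a short move from \<open>v\<close> towards \<open>z\<close> would come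
    closer to \<open>q\<close>, while between \<open>t0\<close> and \<open>t1\<close> the distance
    to \<open>K\<close> is at least \<open>g t1\<close>.\<close>
  have *: "(z - v) \<bullet> (v - q) \<ge> 0"
  proof (rule ccontr)
    assume "\<not> ?thesis"
    then have "(q - v) \<bullet> (z - v) > 0" by (simp add: inner_diff_left inner_diff_right inner_commute)
    then obtain u where u: "u > 0" "\<And>e. e > 0 \<Longrightarrow> e \<le> u \<Longrightarrow> norm (e *\<^sub>R (z - v) - (q - v)) < norm (q - v)"
      using closer_points_lemma by metis
    \<comment> \<open>Moving by \<open>e\<close> towards \<open>z\<close> leads to the parameter
      \<open>t1 - e * t1\<close>; the second bound keeps it at or after \<open>t0\<close>.\<close>
    define e where "e = min u ((t1 - t0) / t1)"
    have t1pos: "t1 > 0" using less t0 by simp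
    have e: "e > 0" "e \<le> u" "e * t1 \<le> t1 - t0"
      using u less t1pos by (auto simp: e_def min_def field_simps)
    define s where "s = t1 - e * t1"
    have "f s = v + e *\<^sub>R (z - v)" by (simp add: s_def f_def v_def algebra_simps)
    then have "f s - q = e *\<^sub>R (z - v) - (q - v)" by simp
    then have "dist (f s) q < dist v q"
      using u(2)[OF e(1,2)] by (simp only: dist_norm norm_minus_commute[of v])
    moreover have "g s \<le> dist (f s) q" unfolding g_def using q(1) by (rule infdist_le)
    moreover have "g t1 \<le> g s" using e t1pos less by (intro before) (auto simp: s_def)
    ultimately show False using q(2) by (simp add: g_def v_def)
  qed
  \<comment> \<open>If \<open>x\<close> were beyond this half-space, the segment from
    \<open>q\<close> to \<open>x\<close> would start by approaching \<open>v\<close> and contain a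
    point of \<open>K\<close> nearer than \<open>q\<close>.\<close>
  have "{x. sees K x q} \<subseteq> {x. (v - q) \<bullet> x \<le> (v - q) \<bullet> q}"
  proof (clarify, rule ccontr)
    fix x assume x: "sees K x q" and "\<not> (v - q) \<bullet> x \<le> (v - q) \<bullet> q"
    then have "(v - q) \<bullet> (x - q) > 0" by (simp add: inner_diff_right)
    then obtain u where u: "u > 0" "u \<le> 1" "dist (q + u *\<^sub>R (x - q)) v < dist q v"
      using closer_point_lemma by blast
    have "q + u *\<^sub>R (x - q) \<in> closed_segment q x"
      using u by (auto simp: closed_segment_def algebra_simps intro!: exI[of _ u])
    then have "q + u *\<^sub>R (x - q) \<in> K" using x by (auto simp: sees_def closed_segment_commute)
    then have "infdist v K \<le> dist v (q + u *\<^sub>R (x - q))" by (rule infdist_le)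
    then show False using u(3) q(2) by (simp add: dist_commute)
  qed
  then have "convex hull {x. sees K x q} \<subseteq> {x. (v - q) \<bullet> x \<le> (v - q) \<bullet> q}"
    by (intro hull_minimal) (auto simp: convex_halfspace_le)
  then have "(v - q) \<bullet> z \<le> (v - q) \<bullet> q" using z[OF q(1)] by blast
  moreover have "(v - q) \<bullet> z - (v - q) \<bullet> q = (z - v) \<bullet> (v - q) + (v - q) \<bullet> (v - q)"
    by (simp add: inner_diff_left inner_diff_right inner_commute)
  moreover have "(v - q) \<bullet> (v - q) > 0" using vq by simp
  ultimately show False using * by linarith
qed

lemma compact_visible:
  fixes K :: "'a::euclidean_space set"
  assumes "compact K" shows "compact {x. sees K x y}"
proof -
  have "{x. sees K x y} = (\<Inter>t\<in>{0..1}. (\<lambda>x. (1 - t) *\<^sub>R x + t *\<^sub>R y) -` K)"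
    by (auto simp: sees_def closed_segment_image_interval image_subset_iff)
  moreover have "closed ((\<lambda>x. (1 - t) *\<^sub>R x + t *\<^sub>R y) -` K)" for t
    using compact_imp_closed[OF assms] by (intro closed_vimage continuous_intros)
  ultimately have "closed {x. sees K x y}" by auto
  moreover have "{x. sees K x y} \<subseteq> K" by (auto simp: sees_def)
  ultimately show ?thesis by (metis assms compact_Int_closed inf.absorb_iff2)
qed

section \<open>The volumetric Krasnoselskii theorem\<close>

text \<open>The empty set is excluded because it satisfies the hypothesis on points vacuously but
  has no subset of positive volume.\<close>

theorem theorem1p3:
  fixes K :: "(real ^ 'n) set"
  defines "d \<equiv> CARD('n)"
  assumes "compact K"
    and "K \<noteq> {}"
    and "\<And>p :: nat \<Rightarrow> real ^ 'n.
           (\<And>i. i < d * (d + 3) div 2 \<Longrightarrow> p i \<in> K) \<Longrightarrow>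
           \<exists>X. X \<subseteq> K \<and> X \<in> sets lebesgue \<and> emeasure lebesgue X = 1 \<and>
               (\<forall>x\<in>X. \<forall>i < d * (d + 3) div 2. sees K x (p i))"
  shows "\<exists>X'. X' \<subseteq> K \<and> X' \<in> sets lebesgue \<and>
              emeasure lebesgue X' = ennreal (1 / real d ^ d) \<and>
              (\<forall>x\<in>X'. \<forall>y\<in>K. sees K x y)"
proof -
  obtain r :: "'n \<Rightarrow> nat" where "bij_betw r UNIV {0..<CARD('n)}"
    using ex_bij_betw_finite_nat[OF finite[of "UNIV :: 'n set"]] by blast
  then have r: "bij_betw r UNIV {..<d}" by (simp add: lessThan_atLeast0 d_def)
  then have inj: "inj r" by (simp add: bij_betw_def)
  obtain y0 where y0: "y0 \<in> K" using assms(3) by blast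
  define H where "H y = convex hull {x. sees K x y}" for y
  have H: "compact (H y)" "convex (H y)" for y
    using assms(2) by (simp_all add: H_def compact_convex_hull compact_visible)
  define \<omega> where "\<omega> = unit_ball_vol (real d)"
  have \<omega>: "\<omega> > 0" by (simp add: \<omega>_def)
  have d: "d > 0" by (simp add: d_def)
  \<comment> \<open>The unit ball has volume \<open>\<omega>\<close>, so this threshold means
    ellipsoid volume at least \<open>1 / real d ^ d\<close>.\<close>
  have "large_matrices r (1 / (\<omega> * real d ^ d)) \<inter> (\<Inter>y\<in>K. inscribed r (H y)) \<noteq> {}"
  proof (rule Helly_ellipsoids[OF inj _ assms(3) H])
    show "0 < 1 / (\<omega> * real d ^ d)" using \<omega> d by simp
    fix Z assume Z: "Z \<subseteq> K" "finite Z" "card Z \<le> CARD('n) * (CARD('n) + 3) div 2"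
    obtain h where h: "bij_betw h {0..<card Z} Z"
      using ex_bij_betw_nat_finite[OF Z(2)] by blast
    \<comment> \<open>The hypothesis takes exactly \<open>d * (d + 3) div 2\<close> points; a
      smaller \<open>Z\<close> is padded with \<open>y0\<close>.\<close>
    define p where "p i = (if i < card Z then h i else y0)" for i
    have hZ: "h i \<in> Z" if "i < card Z" for i
      using bij_betwE[OF h] that by auto
    have "p i \<in> K" for i using hZ Z(1) y0 by (auto simp: p_def)
    then obtain X where X: "X \<subseteq> K" "X \<in> sets lebesgue" "emeasure lebesgue X = 1"
      and sees: "\<And>x i. x \<in> X \<Longrightarrow> i < d * (d + 3) div 2 \<Longrightarrow> sees K x (p i)"
      using assms(4)[of p] by blast
    have seesZ: "sees K x y" if xy: "x \<in> X" "y \<in> Z" for x y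
    proof -
      have "y \<in> h ` {0..<card Z}" using h xy(2) by (simp add: bij_betw_def)
      then obtain i where "i < card Z" "y = h i" by auto
      then show ?thesis using sees[OF xy(1), of i] Z(3) by (simp add: p_def d_def)
    qed
    \<comment> \<open>The hull of \<open>K\<close> keeps \<open>C\<close> compact when
      \<open>Z\<close> is empty and the intersection is the whole space.\<close>
    define C where "C = convex hull K \<inter> (\<Inter>y\<in>Z. H y)"
    have "closed (\<Inter>y\<in>Z. H y)" by (intro closed_INT ballI compact_imp_closed H)
    then have C: "compact C" "convex C"
      unfolding C_def using assms(2) H
      by (auto intro!: compact_Int_closed compact_convex_hull convex_Int convex_INT)
    have "X \<subseteq> C"
    proof -
      have "X \<subseteq> H y" if "y \<in> Z" for y
        using seesZ[OF _ that] hull_subset[of "{x. sees K x y}" convex] by (auto simp: H_def)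
      then show ?thesis
        using X(1) hull_subset[of K convex] by (auto simp: C_def)
    qed
    moreover have "X \<in> lmeasurable" using X by (auto intro: fmeasurableI)
    ultimately have "measure lebesgue X \<le> measure lebesgue C"
      using C(1) by (intro measure_mono_fmeasurable) (auto intro: lmeasurable_compact)
    then have C1: "1 \<le> measure lebesgue C"
      using X(3) by (simp add: measure_def)
    then have "0 < measure lebesgue C" by simp
    then obtain L b where Lb: "(L, b) \<in> inscribed r C"
      "measure lebesgue C \<le> (\<Prod>i\<in>UNIV. L $ i $ i) * (\<omega> * real d ^ d)"
      using inscribed_ellipsoid_volume[OF r[unfolded d_def] C] unfolding \<omega>_def d_def by blast
    have "1 / (\<omega> * real d ^ d) \<le> (\<Prod>i\<in>UNIV. L $ i $ i)"
      using Lb(2) C1 \<omega> d by (simp add: divide_le_eq)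
    then have "(L, b) \<in> large_matrices r (1 / (\<omega> * real d ^ d))"
      using Lb(1) by (simp add: large_matrices_def inscribed_def)
    moreover have "(L, b) \<in> inscribed r (H y)" if "y \<in> Z" for y
      using Lb(1) inscribed_mono[of C "H y" r] that by (auto simp: C_def)
    ultimately show "large_matrices r (1 / (\<omega> * real d ^ d)) \<inter> (\<Inter>y\<in>Z. inscribed r (H y)) \<noteq> {}"
      by blast
  qed
  then obtain L b where large: "(L, b) \<in> large_matrices r (1 / (\<omega> * real d ^ d))"
    and ins: "\<And>y. y \<in> K \<Longrightarrow> (L, b) \<in> inscribed r (H y)" by auto
  have L: "lower_triangular r L" "\<And>i. 0 \<le> L $ i $ i"
    and P1: "1 / (\<omega> * real d ^ d) \<le> (\<Prod>i\<in>UNIV. L $ i $ i)"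
    using large by (auto simp: large_matrices_def)
  define P where "P = (\<Prod>i\<in>UNIV. L $ i $ i)"
  have P: "P > 0" "1 \<le> P * \<omega> * real d ^ d"
  proof -
    have "0 < 1 / (\<omega> * real d ^ d)" using \<omega> d by simp
    then show "P > 0" using P1 unfolding P_def by linarith
    show "1 \<le> P * \<omega> * real d ^ d"
      using P1 \<omega> d by (simp add: P_def divide_le_eq mult.assoc)
  qed
  \<comment> \<open>Shrinking by \<open>s\<close> makes the volume exactly
    \<open>1 / real d ^ d\<close>, and \<open>s \<le> 1\<close> keeps the result inside the original
    ellipsoid.\<close>
  define s where "s = root d (1 / (P * \<omega> * real d ^ d))"
  have s: "0 \<le> s" "s \<le> 1" "s ^ d = 1 / (P * \<omega> * real d ^ d)"
    using P \<omega> d by (auto simp: s_def real_root_pow_pos2 real_root_le_1_iff)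
  define X' where "X' = (\<lambda>t. L *v t + b) ` cball 0 s"
  have "sees K x y" if "x \<in> X'" "y \<in> K" for x y
  proof (rule in_kernel_if_in_hulls[OF compact_imp_closed[OF assms(2)] that(2)])
    fix q assume "q \<in> K"
    obtain t where "norm t \<le> s" "x = L *v t + b" using \<open>x \<in> X'\<close> by (auto simp: X'_def)
    then show "x \<in> convex hull {x. sees K x q}"
      using ins[OF \<open>q \<in> K\<close>] s(2) by (auto simp: inscribed_def H_def)
  qed
  moreover from this[OF _ y0] have "X' \<subseteq> K" by (auto simp: sees_def)
  moreover have X': "X' \<in> lmeasurable"
    "measure lebesgue X' = P * (\<omega> * s ^ d)"
    using measure_ellipsoid[OF inj L s(1), of b] by (simp_all add: X'_def P_def \<omega>_def d_def)
  moreover have "P * (\<omega> * s ^ d) = 1 / real d ^ d"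
    unfolding s(3) using P \<omega> d by simp
  ultimately show ?thesis
    by (intro exI[of _ X']) (auto simp: emeasure_eq_measure2)
qed

end
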